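(* Let $(\mathfrak g,\cdot,\ast)$ be a compatible pre-Lie algebra over a field $\mathbb K$ with $\pi_1(x,y)=x\cdot y$, $\pi_2(x,y)=x\ast y$, and let $(V,\rho,\mu,\tilde\rho,\tilde\mu)$ be a representation of it. For $n\ge1$ let $\mathfrak C^n(\mathfrak g;V)$ be the direct sum of $n$ copies of $C^n(\mathfrak g;V)=\mathrm{Hom}(\wedge^{n-1}\mathfrak g\otimes\mathfrak g,V)$. Define $\partial:\mathfrak C^n(\mathfrak g;V)\to\mathfrak C^{n+1}(\mathfrak g;V)$ by $\partial f=(\partial_{\pi_1+\rho+\mu}f,\partial_{\pi_2+\tilde\rho+\tilde\mu}f)$ for $n=1$, and for $n\ge2$ $$\partial(f_1,\dots,f_n)=(\partial_{\pi_1+\rho+\mu}f_1,\ \dots,\ \partial_{\pi_2+\tilde\rho+\tilde\mu}f_{i-1}+\partial_{\pi_1+\rho+\mu}f_i,\ \dots,\ \partial_{\pi_2+\tilde\rho+\tilde\mu}f_n),$$ where the $i$-th entry is $\partial_{\pi_2+\tilde\rho+\tilde\mu}f_{i-1}+\partial_{\pi_1+\rho+\mu}f_i$ for $2\le i\le n$. Then $\partial\circ\partial=0$.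
   Context: Pre-Lie algebra: a vector space with a bilinear product $\cdot$ satisfying $(x\cdot y)\cdot z-x\cdot(y\cdot z)=(y\cdot x)\cdot z-y\cdot(x\cdot z)$. Compatible pre-Lie algebra: a triple $(\mathfrak g,\cdot,\ast)$ where $\cdot,\ast$ are pre-Lie products such that $(x\ast y)\cdot z+(x\cdot y)\ast z-x\cdot(y\ast z)-x\ast(y\cdot z)-(y\ast x)\cdot z-(y\cdot x)\ast z+y\cdot(x\ast z)+y\ast(x\cdot z)=0$. Representation of a pre-Lie algebra $(\mathfrak g,\cdot)$ on $V$: linear maps $\rho,\mu:\mathfrak g\to\mathfrak{gl}(V)$ with $\rho(x\cdot y-y\cdot x)=\rho(x)\rho(y)-\rho(y)\rho(x)$ and $\mu(y)\mu(x)-\mu(x\cdot y)=\mu(y)\rho(x)-\rho(x)\mu(y)$. Representation of $(\mathfrak g,\cdot,\ast)$: $(V,\rho,\mu,\tilde\rho,\tilde\mu)$ with $(V,\rho,\mu)$ a representation of $(\mathfrak g,\cdot)$, $(V,\tilde\rho,\tilde\mu)$ a representation of $(\mathfrak g,\ast)$, and for all $x,y$: $\rho(x\ast y)+\tilde\rho(x\cdot y)-\rho(x)\tilde\rho(y)-\tilde\rho(x)\rho(y)=\rho(y\ast x)+\tilde\rho(y\cdot x)-\rho(y)\tilde\rho(x)-\tilde\rho(y)\rho(x)$ and $\mu(y)\tilde\rho(x)-\rho(x)\tilde\mu(y)-\mu(y)\tilde\mu(x)+\mu(x\ast y)=-\tilde\mu(y)\rho(x)+\tilde\rho(x)\mu(y)+\tilde\mu(y)\mu(x)-\tilde\mu(x\cdot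 y)$. For a pre-Lie algebra $(\mathfrak g,\pi)$ with representation $(V,r,m)$, the operator $\partial_{\pi+r+m}:C^n(\mathfrak g;V)\to C^{n+1}(\mathfrak g;V)$ is the usual pre-Lie coboundary (writing $[x,y]_\pi=\pi(x,y)-\pi(y,x)$): $$(\partial_{\pi+r+m}f)(x_1,\dots,x_{n+1})=\sum_{i=1}^n(-1)^{i+1}r(x_i)f(x_1,\dots,\hat{x_i},\dots,x_{n+1})+\sum_{i=1}^n(-1)^{i+1}m(x_{n+1})f(x_1,\dots,\hat{x_i},\dots,x_n,x_i)$$ $$-\sum_{i=1}^n(-1)^{i+1}f(x_1,\dots,\hat{x_i},\dots,x_n,\pi(x_i,x_{n+1}))+\sum_{1\le i<j\le n}(-1)^{i+j}f([x_i,x_j]_\pi,x_1,\dots,\hat{x_i},\dots,\hat{x_j},\dots,x_{n+1}).$$ *)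

theory Defs
  imports Main "HOL.Vector_Spaces"
begin

text \<open>Vector spaces over a field are given by a scalar multiplication on a type of class
  \<^class>\<open>ab_group_add\<close>. A linear map into \<open>gl(V)\<close> is written in curried form, as a bilinear map
  \<open>\<gg> \<times> V \<rightarrow> V\<close>.\<close>

definition bilinear_map ::
  "('k::field \<Rightarrow> 'a::ab_group_add \<Rightarrow> 'a) \<Rightarrow> ('k \<Rightarrow> 'b::ab_group_add \<Rightarrow> 'b) \<Rightarrow>
   ('k \<Rightarrow> 'c::ab_group_add \<Rightarrow> 'c) \<Rightarrow> ('a \<Rightarrow> 'b \<Rightarrow> 'c) \<Rightarrow> bool"
  where "bilinear_map s1 s2 s3 b \<longleftrightarrow>
    (\<forall>x. Vector_Spaces.linear s2 s3 (b x)) \<and> (\<forall>y. Vector_Spaces.linear s1 s3 (\<lambda>x. b x y))"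

locale pre_lie_algebra = vector_space scale
  for scale :: "'k::field \<Rightarrow> 'g::ab_group_add \<Rightarrow> 'g" +
  fixes mul :: "'g \<Rightarrow> 'g \<Rightarrow> 'g"
  assumes bilinear_mul: "bilinear_map scale scale scale mul"
    and left_symmetric:
      "mul (mul x y) z - mul x (mul y z) = mul (mul y x) z - mul y (mul x z)"

locale compatible_pre_lie_algebra =
  dot: pre_lie_algebra scale dot + ast: pre_lie_algebra scale ast
  for scale :: "'k::field \<Rightarrow> 'g::ab_group_add \<Rightarrow> 'g"
    and dot :: "'g \<Rightarrow> 'g \<Rightarrow> 'g" and ast :: "'g \<Rightarrow> 'g \<Rightarrow> 'g" +
  assumes compatible:
    "dot (ast x y) z + ast (dot x y) z - dot x (ast y z) - ast x (dot y z)
     - dot (ast y x) z - ast (dot y x) z + dot y (ast x z) + ast y (dot x z) = 0"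

locale pre_lie_representation =
  pre_lie_algebra scale mul + V: vector_space scaleV
  for scale :: "'k::field \<Rightarrow> 'g::ab_group_add \<Rightarrow> 'g"
    and mul :: "'g \<Rightarrow> 'g \<Rightarrow> 'g"
    and scaleV :: "'k \<Rightarrow> 'v::ab_group_add \<Rightarrow> 'v" +
  fixes \<rho> \<mu> :: "'g \<Rightarrow> 'v \<Rightarrow> 'v"
  assumes bilinear_rho: "bilinear_map scale scaleV scaleV \<rho>"
    and bilinear_mu: "bilinear_map scale scaleV scaleV \<mu>"
    and rep_rho: "\<rho> (mul x y - mul y x) v = \<rho> x (\<rho> y v) - \<rho> y (\<rho> x v)"
    and rep_mu: "\<mu> y (\<mu> x v) - \<mu> (mul x y) v = \<mu> y (\<rho> x v) - \<rho> x (\<mu> y v)"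

text \<open>In the representation \<open>(V, \<rho>, \<mu>, \<rho>t, \<mu>t)\<close> the suffix \<open>t\<close> stands for the tilde.\<close>

locale compatible_pre_lie_representation =
  compatible_pre_lie_algebra scale dot ast
  + dot: pre_lie_representation scale dot scaleV \<rho> \<mu>
  + ast: pre_lie_representation scale ast scaleV \<rho>t \<mu>t
  for scale :: "'k::field \<Rightarrow> 'g::ab_group_add \<Rightarrow> 'g"
    and dot :: "'g \<Rightarrow> 'g \<Rightarrow> 'g" and ast :: "'g \<Rightarrow> 'g \<Rightarrow> 'g"
    and scaleV :: "'k \<Rightarrow> 'v::ab_group_add \<Rightarrow> 'v"
    and \<rho> \<mu> \<rho>t \<mu>t :: "'g \<Rightarrow> 'v \<Rightarrow> 'v" +
  assumes compatible_rho:
    "\<rho> (ast x y) v + \<rho>t (dot x y) v - \<rho> x (\<rho>t y v) - \<rho>t x (\<rho> y v)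
     = \<rho> (ast y x) v + \<rho>t (dot y x) v - \<rho> y (\<rho>t x v) - \<rho>t y (\<rho> x v)"
    and compatible_mu:
    "\<mu> y (\<rho>t x v) - \<rho> x (\<mu>t y v) - \<mu> y (\<mu>t x v) + \<mu> (ast x y) v
     = - \<mu>t y (\<rho> x v) + \<rho>t x (\<mu> y v) + \<mu>t y (\<mu> x v) - \<mu>t (dot x y) v"

text \<open>An element of \<open>C\<^sup>n(\<gg>; V) = Hom(\<Lambda>\<^sup>n\<^sup>-\<^sup>1\<gg> \<otimes> \<gg>, V)\<close> is a map that is linear in each of its \<open>n\<close>
  arguments and alternating in the first \<open>n - 1\<close> of them. Its argument tuple is a list of length
  \<open>n\<close>; on lists of any other length it is set to 0, so that equality of cochains is equality of
  functions.\<close>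

definition cochains ::
  "('k::field \<Rightarrow> 'g::ab_group_add \<Rightarrow> 'g) \<Rightarrow> ('k \<Rightarrow> 'v::ab_group_add \<Rightarrow> 'v) \<Rightarrow> nat \<Rightarrow>
   ('g list \<Rightarrow> 'v) set"
  where "cochains scale scaleV n = {f.
    (\<forall>xs i. length xs = n \<and> i < n \<longrightarrow> Vector_Spaces.linear scale scaleV (\<lambda>x. f (xs[i := x]))) \<and>
    (\<forall>xs i j. length xs = n \<and> i < j \<and> j < n - 1 \<and> xs ! i = xs ! j \<longrightarrow> f xs = 0) \<and>
    (\<forall>xs. length xs \<noteq> n \<longrightarrow> f xs = 0)}"

text \<open>The pre-Lie coboundary \<open>C\<^sup>n(\<gg>; V) \<rightarrow> C\<^sup>n\<^sup>+\<^sup>1(\<gg>; V)\<close>. List positions count from 0, so that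
  \<open>x\<^sub>1, \<dots>, x\<^sub>n, x\<^sub>n\<^sub>+\<^sub>1\<close> are \<open>xs ! 0, \<dots>, xs ! (n - 1), xs ! n\<close>; the sign \<open>(-1)\<^sup>i\<^sup>+\<^sup>1\<close> of the usual formula
  becomes \<open>(-1)\<^sup>i\<close>, while \<open>(-1)\<^sup>i\<^sup>+\<^sup>j\<close> is unchanged. The list \<open>nths xs (- I)\<close> is \<open>xs\<close> with the
  positions in \<open>I\<close> omitted.\<close>

definition pre_lie_coboundary ::
  "('k::field \<Rightarrow> 'v::ab_group_add \<Rightarrow> 'v) \<Rightarrow> ('g::ab_group_add \<Rightarrow> 'g \<Rightarrow> 'g) \<Rightarrow>
   ('g \<Rightarrow> 'v \<Rightarrow> 'v) \<Rightarrow> ('g \<Rightarrow> 'v \<Rightarrow> 'v) \<Rightarrow> nat \<Rightarrow> ('g list \<Rightarrow> 'v) \<Rightarrow> ('g list \<Rightarrow> 'v)"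
  where "pre_lie_coboundary scaleV \<pi> r m n f = (\<lambda>xs.
    if length xs = n + 1 then
        (\<Sum>i<n. scaleV ((- 1) ^ i) (r (xs ! i) (f (nths xs (- {i})))))
      + (\<Sum>i<n. scaleV ((- 1) ^ i) (m (xs ! n) (f (nths xs (- {i, n}) @ [xs ! i]))))
      - (\<Sum>i<n. scaleV ((- 1) ^ i) (f (nths xs (- {i, n}) @ [\<pi> (xs ! i) (xs ! n)])))
      + (\<Sum>j<n. \<Sum>i<j. scaleV ((- 1) ^ (i + j))
          (f ((\<pi> (xs ! i) (xs ! j) - \<pi> (xs ! j) (xs ! i)) # nths xs (- {i, j}))))
    else 0)"

text \<open>The direct sum of \<open>n\<close> copies of \<open>C\<^sup>n(\<gg>; V)\<close>, as lists of length \<open>n\<close>.\<close>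

definition compatible_cochains ::
  "('k::field \<Rightarrow> 'g::ab_group_add \<Rightarrow> 'g) \<Rightarrow> ('k \<Rightarrow> 'v::ab_group_add \<Rightarrow> 'v) \<Rightarrow> nat \<Rightarrow>
   ('g list \<Rightarrow> 'v) list set"
  where "compatible_cochains scale scaleV n =
    {fs. length fs = n \<and> set fs \<subseteq> cochains scale scaleV n}"

text \<open>For \<open>n = 1\<close> the middle block is empty and the value is the pair
  \<open>(\<partial>\<^sub>\<pi>\<^sub>1\<^sub>+\<^sub>\<rho>\<^sub>+\<^sub>\<mu> f, \<partial>\<^sub>\<pi>\<^sub>2\<^sub>+\<^sub>\<rho>\<^sub>t\<^sub>+\<^sub>\<mu>\<^sub>t f)\<close>.\<close>

definition compatible_coboundary ::
  "('k::field \<Rightarrow> 'v::ab_group_add \<Rightarrow> 'v) \<Rightarrow> ('g::ab_group_add \<Rightarrow> 'g \<Rightarrow> 'g) \<Rightarrow> ('g \<Rightarrow> 'g \<Rightarrow> 'g) \<Rightarrow>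
   ('g \<Rightarrow> 'v \<Rightarrow> 'v) \<Rightarrow> ('g \<Rightarrow> 'v \<Rightarrow> 'v) \<Rightarrow> ('g \<Rightarrow> 'v \<Rightarrow> 'v) \<Rightarrow> ('g \<Rightarrow> 'v \<Rightarrow> 'v) \<Rightarrow> nat \<Rightarrow>
   ('g list \<Rightarrow> 'v) list \<Rightarrow> ('g list \<Rightarrow> 'v) list"
  where "compatible_coboundary scaleV \<pi>1 \<pi>2 \<rho> \<mu> \<rho>t \<mu>t n fs =
    (let d1 = pre_lie_coboundary scaleV \<pi>1 \<rho> \<mu> n;
         d2 = pre_lie_coboundary scaleV \<pi>2 \<rho>t \<mu>t n
     in [d1 (fs ! 0)]
        @ map (\<lambda>i xs. d2 (fs ! (i - 1)) xs + d1 (fs ! i) xs) [1..<n]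
        @ [d2 (fs ! (n - 1))])"

end

theory Submission
  imports Defs
begin

text \<open>A cochain in \<open>Hom(\<Lambda>\<^sup>n\<^sup>-\<^sup>1\<gg> \<otimes> \<gg>, V)\<close> is a Chevalley--Eilenberg cochain of the commutator Lie
  algebra of \<open>\<gg>\<close> with values in the Lie module \<open>Hom(\<gg>, V)\<close>, on which \<open>x\<close> acts by
  \<open>(x \<phi>)(z) = \<rho> x (\<phi> z) + \<mu> z (\<phi> x) - \<phi> (x \<cdot> z)\<close>. Hence \<open>\<partial>\<^sup>2 = 0\<close> for a single pre-Lie product
  follows from Cartan's calculus, by induction on the number of arguments: the coboundary is
  determined by \<open>\<iota>\<^sub>x \<partial> = \<theta>\<^sub>x - \<partial> \<iota>\<^sub>x\<close>, and it commutes with the Lie derivatives \<open>\<theta>\<^sub>x\<close>.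
  Compatibility says that the sum of the two products, acting through the sum of the two
  representations, is again a pre-Lie product with a representation. Its coboundary is
  \<open>\<partial>\<^sub>1 + \<partial>\<^sub>2\<close>, so that \<open>(\<partial>\<^sub>1 + \<partial>\<^sub>2)\<^sup>2 = 0\<close> yields \<open>\<partial>\<^sub>1 \<partial>\<^sub>2 + \<partial>\<^sub>2 \<partial>\<^sub>1 = 0\<close>.\<close>

section \<open>Multilinear and alternating functions of lists\<close>

text \<open>\<open>c = 1\<close> gives additivity, hence \<open>f 0 = 0\<close>, and then
  \<open>y = 0\<close> gives homogeneity. As a single equation, linearity can be carried through the
  inductions below, with subtraction as the case \<open>c = - 1\<close>.\<close>

lemma (in vector_space_pair) linear_iff_lincomb:
  "Vector_Spaces.linear s1 s2 f \<longleftrightarrow> (\<forall>c x y. f (s1 c x + y) = s2 c (f x) + f y)"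
proof
  assume "Vector_Spaces.linear s1 s2 f"
  then show "\<forall>c x y. f (s1 c x + y) = s2 c (f x) + f y"
    by (simp add: linear_add linear_scale)
next
  assume *: "\<forall>c x y. f (s1 c x + y) = s2 c (f x) + f y"
  have add: "f (x + y) = f x + f y" for x y
    using *[rule_format, of 1 x y] by simp
  have "f 0 = 0" using add[of 0 0] by simp
  then have "f (s1 c x) = s2 c (f x)" for c x
    using *[rule_format, of c x 0] by simp
  with add show "Vector_Spaces.linear s1 s2 f"
    unfolding linear_iff by (simp add: vs1.vector_space_axioms vs2.vector_space_axioms)
qed

text \<open>No length is fixed, so the property survives fixing the first entry, as inductions over
  argument lists require.\<close>

definition multilinear ::
  "('k::field \<Rightarrow> 'g::ab_group_add \<Rightarrow> 'g) \<Rightarrow> ('k \<Rightarrow> 'v::ab_group_add \<Rightarrow> 'v) \<Rightarrow> ('g list \<Rightarrow> 'v) \<Rightarrow> bool"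
  where "multilinear s sV f \<longleftrightarrow> (\<forall>as bs. Vector_Spaces.linear s sV (\<lambda>x. f (as @ x # bs)))"

text \<open>Adjacent repetitions suffice for multilinear functions; \<open>bs \<noteq> []\<close>
  exempts the last slot, in which no symmetry is imposed.\<close>

definition alternating :: "('g list \<Rightarrow> 'v::ab_group_add) \<Rightarrow> bool"
  where "alternating f \<longleftrightarrow> (\<forall>as x bs. bs \<noteq> [] \<longrightarrow> f (as @ x # x # bs) = 0)"

lemma alternating_Cons: "alternating f \<Longrightarrow> alternating (\<lambda>l. f (x # l))"
  unfolding alternating_def by (metis append_Cons)

context vector_space_pair
begin

lemma multilinear_lincomb:
  "multilinear s1 s2 f \<Longrightarrow> f (as @ (s1 c x + y) # bs) = s2 c (f (as @ x # bs)) + f (as @ y # bs)"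
  unfolding multilinear_def linear_iff_lincomb by blast

lemma multilinear_lincomb_Cons:
  "multilinear s1 s2 f \<Longrightarrow> f ((s1 c x + y) # bs) = s2 c (f (x # bs)) + f (y # bs)"
  using multilinear_lincomb[of f "[]"] by simp

lemma multilinear_lincombI:
  "(\<And>as bs c x y. f (as @ (s1 c x + y) # bs) = s2 c (f (as @ x # bs)) + f (as @ y # bs)) \<Longrightarrow>
    multilinear s1 s2 f"
  unfolding multilinear_def linear_iff_lincomb by blast

lemma multilinear_Cons: "multilinear s1 s2 f \<Longrightarrow> multilinear s1 s2 (\<lambda>l. f (x # l))"
  unfolding multilinear_def
proof (intro allI)
  fix as bs
  assume "\<forall>as bs. Vector_Spaces.linear s1 s2 (\<lambda>y. f (as @ y # bs))"
  from this[rule_format, of "x # as" bs]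
  show "Vector_Spaces.linear s1 s2 (\<lambda>y. f (x # as @ y # bs))" by simp
qed

lemma multilinear_add:
  "multilinear s1 s2 f \<Longrightarrow> f (as @ (x + y) # bs) = f (as @ x # bs) + f (as @ y # bs)"
  using multilinear_lincomb[of f as 1] by simp

lemma multilinear_diff:
  "multilinear s1 s2 f \<Longrightarrow> f (as @ (x - y) # bs) = f (as @ x # bs) - f (as @ y # bs)"
  using multilinear_lincomb[of f as "- 1" y x] by simp

text \<open>Polarisation: expand the vanishing value at the repeated entry
  \<open>x + y\<close>.\<close>

lemma multilinear_skew:
  assumes f: "multilinear s1 s2 f" and alt: "alternating f" and "bs \<noteq> []"
  shows "f (as @ x # y # bs) = - f (as @ y # x # bs)"
proof -
  have "f (as @ (x + y) # (x + y) # bs) = 0"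
    using alt \<open>bs \<noteq> []\<close> unfolding alternating_def by blast
  moreover have "f (as @ (x + y) # (x + y) # bs) =
      f (as @ x # x # bs) + f (as @ x # y # bs) + (f (as @ y # x # bs) + f (as @ y # y # bs))"
    using multilinear_add[OF f, of as x y] multilinear_add[OF f, of "as @ [x]" x y bs]
      multilinear_add[OF f, of "as @ [y]" x y bs]
    by simp
  moreover have "f (as @ x # x # bs) = 0" "f (as @ y # y # bs) = 0"
    using alt \<open>bs \<noteq> []\<close> unfolding alternating_def by blast+
  ultimately show ?thesis by (simp add: eq_neg_iff_add_eq_0)
qed

text \<open>Transpositions carry the first \<open>x\<close> rightwards through \<open>cs\<close>
  until the two copies are adjacent.\<close>

lemma multilinear_alternating_repeat:
  assumes f: "multilinear s1 s2 f" and alt: "alternating f" and "bs \<noteq> []"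
  shows "f (as @ x # cs @ x # bs) = 0"
proof (induction cs arbitrary: as)
  case Nil
  then show ?case using alt \<open>bs \<noteq> []\<close> unfolding alternating_def by simp
next
  case (Cons c cs)
  show ?case
    using multilinear_skew[OF f alt, of "cs @ x # bs" as x c] Cons[of "as @ [c]"] by simp
qed

text \<open>On lists of length other than \<open>n\<close> the function is zero, so the conditions
  over positions extend to all lists. Conversely, non-adjacent repetitions reduce to adjacent
  ones.\<close>

lemma cochains_iff:
  "f \<in> cochains s1 s2 n \<longleftrightarrow>
    multilinear s1 s2 f \<and> alternating f \<and> (\<forall>xs. length xs \<noteq> n \<longrightarrow> f xs = 0)"
proof
  assume f: "f \<in> cochains s1 s2 n"
  then have lin: "\<And>xs i. length xs = n \<Longrightarrow> i < n \<Longrightarrow> Vector_Spaces.linear s1 s2 (\<lambda>x. f (xs[i := x]))"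
    and alt: "\<And>xs i j. length xs = n \<Longrightarrow> i < j \<Longrightarrow> j < n - 1 \<Longrightarrow> xs ! i = xs ! j \<Longrightarrow> f xs = 0"
    and zero: "\<And>xs. length xs \<noteq> n \<Longrightarrow> f xs = 0"
    unfolding cochains_def by blast+
  have "Vector_Spaces.linear s1 s2 (\<lambda>x. f (as @ x # bs))" for as bs
  proof (cases "length as + length bs + 1 = n")
    case True
    then show ?thesis using lin[of "as @ undefined # bs" "length as"] by simp
  next
    case False
    then have "f (as @ x # bs) = 0" for x by (intro zero) simp
    then show ?thesis by (simp add: linear_iff_lincomb)
  qed
  moreover have "f (as @ x # x # bs) = 0" if "bs \<noteq> []" for as x bs
  proof (cases "length as + length bs + 2 = n")
    case True
    have "length as + 1 < n - 1" using True that by (cases bs) auto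
    then show ?thesis
      using True alt[of "as @ x # x # bs" "length as" "length as + 1"] by (simp add: nth_append)
  next
    case False
    then show ?thesis by (intro zero) simp
  qed
  ultimately show "multilinear s1 s2 f \<and> alternating f \<and> (\<forall>xs. length xs \<noteq> n \<longrightarrow> f xs = 0)"
    using zero unfolding multilinear_def alternating_def by blast
next
  assume f: "multilinear s1 s2 f \<and> alternating f \<and> (\<forall>xs. length xs \<noteq> n \<longrightarrow> f xs = 0)"
  have "Vector_Spaces.linear s1 s2 (\<lambda>x. f (xs[i := x]))" if "length xs = n" "i < n" for xs i
    using f that unfolding multilinear_def by (simp add: upd_conv_take_nth_drop)
  moreover have "f xs = 0" if "length xs = n" "i < j" "j < n - 1" "xs ! i = xs ! j" for xs i j
  proof -
    \<comment> \<open>Split \<open>xs\<close> at positions \<open>i\<close> and \<open>j\<close>;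
      the tail after \<open>j\<close> is nonempty because \<open>j < n - 1\<close>.\<close>
    have "drop (Suc i) xs =
        take (j - Suc i) (drop (Suc i) xs) @ drop (Suc i) xs ! (j - Suc i) # drop (Suc (j - Suc i)) (drop (Suc i) xs)"
      using that by (intro id_take_nth_drop) simp
    moreover have "drop (Suc i) xs ! (j - Suc i) = xs ! i"
      using that by simp
    moreover have "xs = take i xs @ xs ! i # drop (Suc i) xs"
      using that by (intro id_take_nth_drop) simp
    ultimately obtain as cs x bs where xs: "xs = as @ x # cs @ x # bs"
      and bs: "bs = drop (Suc (j - Suc i)) (drop (Suc i) xs)"
      by metis
    have "bs \<noteq> []" using that bs by simp
    then show ?thesis
      unfolding xs using f by (intro multilinear_alternating_repeat) auto
  qed
  ultimately show "f \<in> cochains s1 s2 n"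
    using f unfolding cochains_def by blast
qed

end

lemma nths_Cons_omit:
  "nths (x # xs) (- {0}) = xs"
  "nths (x # xs) (- {Suc i}) = x # nths xs (- {i})"
  "nths (x # xs) (- {0, Suc j}) = nths xs (- {j})"
  "nths (x # xs) (- {Suc i, Suc j}) = x # nths xs (- {i, j})"
  by (simp_all add: nths_Cons nths_all Compl_eq)

lemma nths_omit_neq_Nil: "m < length xs \<Longrightarrow> m \<notin> I \<Longrightarrow> nths xs (- I) \<noteq> []"
  using set_nths[of xs "- I"] by auto

section \<open>Lie derivative and Cartan's formula\<close>

text \<open>The last list entry is the argument of the \<open>Hom(\<gg>, V)\<close>-value of the cochain.\<close>

fun lie_derivative ::
  "('g::ab_group_add \<Rightarrow> 'g \<Rightarrow> 'g) \<Rightarrow> ('g \<Rightarrow> 'v::ab_group_add \<Rightarrow> 'v) \<Rightarrow> ('g \<Rightarrow> 'v \<Rightarrow> 'v) \<Rightarrow>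
    'g \<Rightarrow> ('g list \<Rightarrow> 'v) \<Rightarrow> 'g list \<Rightarrow> 'v"
  where
    "lie_derivative \<pi> r m x f [] = 0"
  | "lie_derivative \<pi> r m x f [z] = r x (f [z]) + m z (f [x]) - f [\<pi> x z]"
  | "lie_derivative \<pi> r m x f (y # u # us) =
      lie_derivative \<pi> r m x (\<lambda>l. f (y # l)) (u # us) - f ((\<pi> x y - \<pi> y x) # u # us)"

text \<open>The recursion is Cartan's formula, with contraction \<iota>_x being
  \<open>\<lambda>l. f (x # l)\<close>. The argument list comes first because the recursion runs
  over it while \<open>f\<close> varies.\<close>

primrec cartan_coboundary ::
  "('g::ab_group_add \<Rightarrow> 'g \<Rightarrow> 'g) \<Rightarrow> ('g \<Rightarrow> 'v::ab_group_add \<Rightarrow> 'v) \<Rightarrow> ('g \<Rightarrow> 'v \<Rightarrow> 'v) \<Rightarrow>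
    'g list \<Rightarrow> ('g list \<Rightarrow> 'v) \<Rightarrow> 'v"
  where
    "cartan_coboundary \<pi> r m [] f = 0"
  | "cartan_coboundary \<pi> r m (x # xs) f =
      lie_derivative \<pi> r m x f xs - cartan_coboundary \<pi> r m xs (\<lambda>l. f (x # l))"

text \<open>Follows the equations of \<open>lie_derivative\<close>: entries are stripped from the
  front, but the last one is kept.\<close>

lemma list_induct_singleton [case_names Nil Single Cons2]:
  assumes "P []" "\<And>z. P [z]" "\<And>y u us. P (u # us) \<Longrightarrow> P (y # u # us)"
  shows "P xs"
  by (rule induct_list012) (use assms in auto)

text \<open>Only values of \<open>f\<close> at nonempty lists enter. The restriction matters because
  the third equation of \<open>lie_derivative\<close> unfolds \<open>y # l\<close> only for nonempty
  \<open>l\<close>.\<close>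

lemma lie_derivative_cong:
  "(\<And>l. l \<noteq> [] \<Longrightarrow> f l = g l) \<Longrightarrow> lie_derivative \<pi> r m x f xs = lie_derivative \<pi> r m x g xs"
proof (induction xs arbitrary: f g rule: list_induct_singleton)
  case (Cons2 y u us)
  show ?case using Cons2.IH[of "\<lambda>l. f (y # l)" "\<lambda>l. g (y # l)"] Cons2.prems by simp
qed simp_all

lemma cartan_coboundary_cong:
  "(\<And>l. l \<noteq> [] \<Longrightarrow> f l = g l) \<Longrightarrow> cartan_coboundary \<pi> r m xs f = cartan_coboundary \<pi> r m xs g"
proof (induction xs arbitrary: f g)
  case (Cons x xs)
  show ?case
    using Cons.IH[of "\<lambda>l. f (x # l)" "\<lambda>l. g (x # l)"] lie_derivative_cong[of f g] Cons.prems
    by simp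
qed simp

context pre_lie_representation
begin

abbreviation bracket :: "'g \<Rightarrow> 'g \<Rightarrow> 'g"
  where "bracket x y \<equiv> mul x y - mul y x"

abbreviation LD :: "'g \<Rightarrow> ('g list \<Rightarrow> 'v) \<Rightarrow> 'g list \<Rightarrow> 'v"
  where "LD \<equiv> lie_derivative mul \<rho> \<mu>"

abbreviation d :: "('g list \<Rightarrow> 'v) \<Rightarrow> 'g list \<Rightarrow> 'v"
  where "d f xs \<equiv> cartan_coboundary mul \<rho> \<mu> xs f"

sublocale pair: vector_space_pair scale scaleV ..
sublocale self: vector_space_pair scale scale ..
sublocale selfV: vector_space_pair scaleV scaleV ..

lemma bilinear_lincomb:
  "mul (scale c x + x') y = scale c (mul x y) + mul x' y"
  "mul y (scale c x + x') = scale c (mul y x) + mul y x'"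
  "\<rho> (scale c x + x') v = scaleV c (\<rho> x v) + \<rho> x' v"
  "\<rho> y (scaleV c v + v') = scaleV c (\<rho> y v) + \<rho> y v'"
  "\<mu> (scale c x + x') v = scaleV c (\<mu> x v) + \<mu> x' v"
  "\<mu> y (scaleV c v + v') = scaleV c (\<mu> y v) + \<mu> y v'"
  using bilinear_mul bilinear_rho bilinear_mu
  unfolding bilinear_map_def pair.linear_iff_lincomb self.linear_iff_lincomb selfV.linear_iff_lincomb
  by simp_all

lemma module_diff:
  "\<rho> y (v - w) = \<rho> y v - \<rho> y w"
  "\<mu> y (v - w) = \<mu> y v - \<mu> y w"
  using bilinear_lincomb(4,6)[of y "- 1" w v] by simp_all

lemma module_add:
  "\<rho> y (v + w) = \<rho> y v + \<rho> y w"
  "\<mu> y (v + w) = \<mu> y v + \<mu> y w"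
  using bilinear_lincomb(4,6)[of y 1 v w] by simp_all

lemma module_zero: "\<rho> y 0 = 0" "\<mu> y 0 = 0"
  using module_diff[of y 0 0] by simp_all

lemma mul_diff:
  "mul (x - x') y = mul x y - mul x' y"
  "mul y (x - x') = mul y x - mul y x'"
  using bilinear_lincomb(1)[of "- 1" x' x y] bilinear_lincomb(2)[of y "- 1" x' x] by simp_all

lemma bracket_lincomb:
  "bracket (scale c x + x') y = scale c (bracket x y) + bracket x' y"
  "bracket y (scale c x + x') = scale c (bracket y x) + bracket y x'"
  by (simp_all add: bilinear_lincomb scale_right_diff_distrib)

text \<open>The Jacobi defect is the cyclic sum of skew-symmetrised associators, each of which
  vanishes by left symmetry.\<close>

lemma jacobi: "bracket (bracket x y) z = bracket x (bracket y z) - bracket y (bracket x z)"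
proof -
  let ?a = "\<lambda>x y z. mul (mul x y) z - mul x (mul y z)"
  have "bracket (bracket x y) z - (bracket x (bracket y z) - bracket y (bracket x z)) =
      (?a x y z - ?a y x z) + (?a y z x - ?a z y x) + (?a z x y - ?a x z y)"
    by (simp add: mul_diff algebra_simps)
  also have "\<dots> = 0"
    using left_symmetric[of x y z] left_symmetric[of y z x] left_symmetric[of z x y] by simp
  finally show ?thesis by simp
qed

lemma LD_lincomb_fun:
  "LD x (\<lambda>l. scaleV c (f l) + g l) xs = scaleV c (LD x f xs) + LD x g xs"
  by (induction xs arbitrary: f g rule: list_induct_singleton)
    (simp_all add: bilinear_lincomb V.scale_right_diff_distrib V.scale_right_distrib)

lemma LD_diff_fun: "LD x (\<lambda>l. f l - g l) xs = LD x f xs - LD x g xs"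
  using LD_lincomb_fun[of x "- 1" g f xs] by simp

lemma LD_zero_fun: "LD x (\<lambda>l. 0) xs = 0"
  using LD_diff_fun[of x "\<lambda>l. 0" "\<lambda>l. 0" xs] by simp

lemma d_lincomb_fun:
  "d (\<lambda>l. scaleV c (f l) + g l) xs = scaleV c (d f xs) + d g xs"
  by (induction xs arbitrary: f g)
    (simp_all add: LD_lincomb_fun V.scale_right_diff_distrib V.scale_right_distrib)

lemma d_diff_fun: "d (\<lambda>l. f l - g l) xs = d f xs - d g xs"
  using d_lincomb_fun[where c = "- 1" and f = g and g = f] by simp

lemma d_add_fun: "d (\<lambda>l. f l + g l) xs = d f xs + d g xs"
  using d_lincomb_fun[where c = 1] by simp

lemma d_zero_fun: "d (\<lambda>l. 0) xs = 0"
  using d_diff_fun[where f = "\<lambda>l. 0" and g = "\<lambda>l. 0"] by simp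

lemma LD_lincomb:
  "multilinear scale scaleV f \<Longrightarrow> LD (scale c x + y) f xs = scaleV c (LD x f xs) + LD y f xs"
proof (induction xs arbitrary: f rule: list_induct_singleton)
  case (Cons2 z u us)
  then show ?case
    using Cons2.IH[OF pair.multilinear_Cons[OF Cons2.prems, of z]]
    by (simp add: bracket_lincomb pair.multilinear_lincomb_Cons[OF Cons2.prems] V.scale_right_diff_distrib)
next
  case (Single z)
  then show ?case
    by (simp add: bilinear_lincomb pair.multilinear_lincomb_Cons[OF Single]
        V.scale_right_diff_distrib V.scale_right_distrib)
qed simp

lemma multilinear_LD:
  assumes "multilinear scale scaleV f"
  shows "multilinear scale scaleV (LD x f)"
proof (rule pair.multilinear_lincombI)
  fix as bs c y z
  show "LD x f (as @ (scale c y + z) # bs) = scaleV c (LD x f (as @ y # bs)) + LD x f (as @ z # bs)"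
    using assms
  proof (induction as arbitrary: f)
    case Nil
    note lincomb = pair.multilinear_lincomb_Cons[OF Nil]
    show ?case
    proof (cases bs)
      case Nil
      then show ?thesis
        by (simp add: bilinear_lincomb lincomb V.scale_right_diff_distrib V.scale_right_distrib)
    next
      case Cons
      then show ?thesis
        by (simp add: bracket_lincomb lincomb LD_lincomb_fun V.scale_right_diff_distrib)
    qed
  next
    case (Cons a as)
    \<comment> \<open>The rest of the list contains \<open>w\<close>, so it is nonempty and the
      recursive equation applies; the case split only exposes its head.\<close>
    have LD_Cons: "LD x f (a # as @ w # bs) = LD x (\<lambda>l. f (a # l)) (as @ w # bs) - f (bracket x a # as @ w # bs)" for w
      by (cases as) simp_all
    show ?case
      using Cons.IH[OF pair.multilinear_Cons[OF Cons.prems, of a]]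
        pair.multilinear_lincomb[OF Cons.prems, of "bracket x a # as" c y z bs]
      by (simp add: LD_Cons V.scale_right_diff_distrib)
  qed
qed

lemma multilinear_d:
  assumes "multilinear scale scaleV f"
  shows "multilinear scale scaleV (d f)"
proof (rule pair.multilinear_lincombI)
  fix as bs c y z
  show "d f (as @ (scale c y + z) # bs) = scaleV c (d f (as @ y # bs)) + d f (as @ z # bs)"
    using assms
  proof (induction as arbitrary: f)
    case Nil
    then show ?case
      by (simp add: LD_lincomb d_lincomb_fun pair.multilinear_lincomb_Cons[OF Nil] V.scale_right_diff_distrib)
  next
    case (Cons a as)
    then show ?case
      using pair.multilinear_lincomb[OF multilinear_LD[OF Cons.prems, of a], of as c y z bs]
        Cons.IH[OF pair.multilinear_Cons[OF Cons.prems, of a]]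
      by (simp add: V.scale_right_diff_distrib)
  qed
qed

text \<open>On singletons this is the Lie module axiom for Hom(\<gg>, V). In the induction step the
  mixed terms are symmetric in \<open>x\<close> and \<open>y\<close> and cancel, and the double
  brackets match by the Jacobi identity.\<close>

lemma LD_bracket:
  "multilinear scale scaleV f \<Longrightarrow> LD (bracket x y) f xs = LD x (LD y f) xs - LD y (LD x f) xs"
proof (induction xs arbitrary: f rule: list_induct_singleton)
  case (Single z)
  have f_diff: "f [u - v] = f [u] - f [v]" for u v
    using pair.multilinear_diff[OF Single, of "[]" u v "[]"] by simp
  \<comment> \<open>Left symmetry is solved for \<open>mul (bracket x y) z\<close> and
    \<open>rep_mu\<close> for \<open>\<mu> (mul u z) v\<close>, so that both serve as rewrite
    rules.\<close>
  have mul_z: "mul (bracket x y) z = mul x (mul y z) - mul y (mul x z)"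
    using left_symmetric[of x y z] by (simp add: mul_diff algebra_simps)
  have mu_mul: "\<mu> (mul u z) v = \<mu> z (\<mu> u v) - \<mu> z (\<rho> u v) + \<rho> u (\<mu> z v)" for u v
    using rep_mu[of z u v] by (simp add: algebra_simps)
  show ?case
    by (simp add: f_diff mul_z mu_mul rep_rho module_diff module_add)
next
  case (Cons2 z u us)
  have f_diff: "f ((v - w) # u # us) = f (v # u # us) - f (w # u # us)" for v w
    using pair.multilinear_diff[OF Cons2.prems, of "[]" v w] by simp
  have LD_LD: "LD v (LD w f) (z # u # us) =
      LD v (LD w (\<lambda>l. f (z # l))) (u # us) - LD v (\<lambda>l. f (bracket w z # l)) (u # us)
      - LD w (\<lambda>l. f (bracket v z # l)) (u # us) + f (bracket w (bracket v z) # u # us)" for v w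
  proof -
    have "LD v (\<lambda>l. LD w f (z # l)) (u # us) =
        LD v (\<lambda>l. LD w (\<lambda>l. f (z # l)) l - f (bracket w z # l)) (u # us)"
      by (intro lie_derivative_cong) (auto simp: neq_Nil_conv)
    then show ?thesis by (simp add: LD_diff_fun)
  qed
  have "LD (bracket x y) f (z # u # us) =
      LD (bracket x y) (\<lambda>l. f (z # l)) (u # us) - f (bracket (bracket x y) z # u # us)"
    by simp
  also have "f (bracket (bracket x y) z # u # us) =
      f (bracket x (bracket y z) # u # us) - f (bracket y (bracket x z) # u # us)"
    unfolding jacobi by (rule f_diff)
  also have "LD (bracket x y) (\<lambda>l. f (z # l)) (u # us) =
      LD x (LD y (\<lambda>l. f (z # l))) (u # us) - LD y (LD x (\<lambda>l. f (z # l))) (u # us)"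
    by (rule Cons2.IH[OF pair.multilinear_Cons[OF Cons2.prems]])
  finally show ?case
    unfolding LD_LD by (simp add: algebra_simps del: lie_derivative.simps)
qed simp

text \<open>Contract with \<open>y\<close>, using \<iota>_y \<theta>_x = \<theta>_x \<iota>_y -
  \<iota>_[x,y]. The difference of the two sides becomes the defect in \<open>LD_bracket\<close> and
  the claim for \<iota>_y f.\<close>

lemma LD_d_commute:
  "multilinear scale scaleV f \<Longrightarrow> LD x (d f) xs = d (LD x f) xs"
proof (induction xs arbitrary: f rule: list_induct_singleton)
  case (Cons2 y u us)
  have "d (\<lambda>l. LD x f (y # l)) (u # us) = d (\<lambda>l. LD x (\<lambda>l. f (y # l)) l - f (bracket x y # l)) (u # us)"
    by (intro cartan_coboundary_cong) (auto simp: neq_Nil_conv)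
  also have "\<dots> = d (LD x (\<lambda>l. f (y # l))) (u # us) - d (\<lambda>l. f (bracket x y # l)) (u # us)"
    by (rule d_diff_fun)
  finally have right: "d (LD x f) (y # u # us) = LD y (LD x f) (u # us)
      - (d (LD x (\<lambda>l. f (y # l))) (u # us) - d (\<lambda>l. f (bracket x y # l)) (u # us))"
    unfolding cartan_coboundary.simps(2)[of _ _ _ y] by simp
  have "LD x (d f) (y # u # us) = LD x (\<lambda>l. LD y f l - d (\<lambda>l. f (y # l)) l) (u # us)
      - (LD (bracket x y) f (u # us) - d (\<lambda>l. f (bracket x y # l)) (u # us))"
    unfolding lie_derivative.simps(3) cartan_coboundary.simps(2)[of _ _ _ y]
      cartan_coboundary.simps(2)[of _ _ _ "bracket x y"] ..
  also have "\<dots> = LD x (LD y f) (u # us) - LD x (d (\<lambda>l. f (y # l))) (u # us)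
      - (LD (bracket x y) f (u # us) - d (\<lambda>l. f (bracket x y # l)) (u # us))"
    by (simp only: LD_diff_fun)
  finally show ?case
    unfolding right LD_bracket[OF Cons2.prems] Cons2.IH[OF pair.multilinear_Cons[OF Cons2.prems]]
    by (simp del: lie_derivative.simps cartan_coboundary.simps)
qed (simp_all add: module_zero)

text \<open>Cartan's formula applied twice gives \<iota>_x d d f = (\<theta>_x d - d \<theta>_x) f +
  d d \<iota>_x f.\<close>

theorem d_d: "multilinear scale scaleV f \<Longrightarrow> d (d f) xs = 0"
proof (induction xs arbitrary: f)
  case (Cons x xs)
  have "d (d f) (x # xs) = LD x (d f) xs - d (LD x f) xs + d (d (\<lambda>l. f (x # l))) xs"
    by (simp add: d_diff_fun)
  then show ?case
    using LD_d_commute[OF Cons.prems] Cons.IH[OF pair.multilinear_Cons[OF Cons.prems]] by simp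
qed simp

text \<open>For a repeated pair at the head, the two bracket terms differ by a transposition and
  cancel; what remains has \<open>y, y\<close> in front.\<close>

lemma alternating_LD:
  assumes "multilinear scale scaleV f" "alternating f"
  shows "alternating (LD x f)"
  unfolding alternating_def
proof (intro allI impI)
  fix as y and bs :: "'g list"
  assume "bs \<noteq> []"
  show "LD x f (as @ y # y # bs) = 0"
    using assms
  proof (induction as arbitrary: f)
    case Nil
    have "(\<lambda>l. f (y # y # l)) l = 0" if "l \<noteq> []" for l
      using Nil(2) that unfolding alternating_def by (metis append_Nil)
    then have "LD x (\<lambda>l. f (y # y # l)) bs = 0"
      using lie_derivative_cong[of "\<lambda>l. f (y # y # l)" "\<lambda>l. 0"] LD_zero_fun by metis
    then show ?case
      using \<open>bs \<noteq> []\<close> pair.multilinear_skew[OF Nil, of bs "[]" y "bracket x y"]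
      by (cases bs) simp_all
  next
    case (Cons a as)
    have "LD x f (a # as @ y # y # bs) =
        LD x (\<lambda>l. f (a # l)) (as @ y # y # bs) - f (bracket x a # as @ y # y # bs)"
      by (cases as) simp_all
    moreover have "f ((bracket x a # as) @ y # y # bs) = 0"
      using Cons.prems(2) \<open>bs \<noteq> []\<close> unfolding alternating_def by blast
    ultimately show ?case
      using Cons.IH[OF pair.multilinear_Cons[OF Cons.prems(1)] alternating_Cons[OF Cons.prems(2)]]
      by simp
  qed
qed

text \<open>For a pair at the head, two Cartan steps produce
  \<open>LD y (\<lambda>l. f (y # l)) bs\<close> with opposite signs, a term in
  \<open>bracket y y = 0\<close>, and the coboundary of a function vanishing on nonempty
  lists.\<close>

lemma alternating_d:
  assumes "multilinear scale scaleV f" "alternating f"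
  shows "alternating (d f)"
  unfolding alternating_def
proof (intro allI impI)
  fix as y and bs :: "'g list"
  assume "bs \<noteq> []"
  show "d f (as @ y # y # bs) = 0"
    using assms
  proof (induction as arbitrary: f)
    case Nil
    have "(\<lambda>l. f (y # y # l)) l = 0" if "l \<noteq> []" for l
      using Nil(2) that unfolding alternating_def by (metis append_Nil)
    then have "d (\<lambda>l. f (y # y # l)) bs = 0"
      using cartan_coboundary_cong[of "\<lambda>l. f (y # y # l)" "\<lambda>l. 0"] d_zero_fun by metis
    moreover have "f (0 # bs) = 0"
      using pair.multilinear_diff[OF Nil(1), of "[]" 0 0 bs] by simp
    ultimately show ?case
      using \<open>bs \<noteq> []\<close> by (cases bs) simp_all
  next
    case (Cons a as)
    have "LD a f (as @ y # y # bs) = 0"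
      using alternating_LD[OF Cons.prems] \<open>bs \<noteq> []\<close> unfolding alternating_def by blast
    then show ?case
      using Cons.IH[OF pair.multilinear_Cons[OF Cons.prems(1)] alternating_Cons[OF Cons.prems(2)]]
      by simp
  qed
qed

lemma LD_wrong_length:
  "(\<And>xs. length xs \<noteq> n \<Longrightarrow> f xs = 0) \<Longrightarrow> length xs \<noteq> n \<Longrightarrow> LD x f xs = 0"
proof (induction xs arbitrary: f n rule: list_induct_singleton)
  case (Cons2 y u us)
  have "LD x (\<lambda>l. f (y # l)) (u # us) = 0"
  proof (cases n)
    case 0
    then show ?thesis using Cons2.prems(1) by (simp add: LD_zero_fun)
  next
    case (Suc k)
    then show ?thesis using Cons2 by (intro Cons2.IH[of k]) auto
  qed
  then show ?case using Cons2.prems by simp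
qed (simp_all add: module_zero)

lemma d_wrong_length:
  "(\<And>xs. length xs \<noteq> n \<Longrightarrow> f xs = 0) \<Longrightarrow> length xs \<noteq> n + 1 \<Longrightarrow> d f xs = 0"
proof (induction xs arbitrary: f n)
  case (Cons x xs)
  have "d (\<lambda>l. f (x # l)) xs = 0"
  proof (cases n)
    case 0
    then show ?thesis using Cons.prems(1) by (simp add: d_zero_fun)
  next
    case (Suc k)
    then show ?thesis using Cons by (intro Cons.IH[of k]) auto
  qed
  then show ?case using LD_wrong_length[of n f xs x] Cons.prems by simp
qed simp

lemma d_cochains:
  "f \<in> cochains scale scaleV n \<Longrightarrow> d f \<in> cochains scale scaleV (n + 1)"
  unfolding pair.cochains_iff using multilinear_d alternating_d d_wrong_length[of n f] by blast


section \<open>Agreement with the explicit coboundary formula\<close>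

text \<open>The recursion leaves the bracket at position \<open>j\<close>; moving it to the front
  takes \<open>j\<close> transpositions, hence the sign \<open>(- 1) ^ j\<close>.\<close>

lemma LD_explicit:
  assumes "multilinear scale scaleV f" "alternating f" "length xs = Suc m"
  shows "LD x f xs = \<rho> x (f xs) + \<mu> (xs ! m) (f (nths xs (- {m}) @ [x]))
    - f (nths xs (- {m}) @ [mul x (xs ! m)])
    - (\<Sum>j<m. scaleV ((- 1) ^ j) (f (bracket x (xs ! j) # nths xs (- {j}))))"
  using assms
proof (induction xs arbitrary: f m rule: list_induct_singleton)
  case (Cons2 y u us)
  then obtain k where m: "m = Suc k" and len: "length (u # us) = Suc k" by simp
  \<comment> \<open>Position \<open>k\<close>, the last one, survives the omission of
    \<open>j < k\<close>, so both swapped slots are alternating ones.\<close>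
  have skew: "f (bracket x ((u # us) ! j) # y # nths (u # us) (- {j})) =
      - f (y # bracket x ((u # us) ! j) # nths (u # us) (- {j}))" if "j < k" for j
    using pair.multilinear_skew[OF Cons2.prems(1,2), of "nths (u # us) (- {j})" "[]"]
      nths_omit_neq_Nil[of k "u # us" "{j}"] that len by (metis append_Nil lessI nat_neq_iff singletonD)
  have "(\<Sum>j<m. scaleV ((- 1) ^ j) (f (bracket x ((y # u # us) ! j) # nths (y # u # us) (- {j})))) =
      f (bracket x y # u # us)
      + (\<Sum>j<k. scaleV ((- 1) ^ j) (f (y # bracket x ((u # us) ! j) # nths (u # us) (- {j}))))"
    unfolding m sum.lessThan_Suc_shift using skew by (simp add: nths_Cons_omit)
  then show ?case
    using Cons2.IH[OF pair.multilinear_Cons[OF Cons2.prems(1), of y]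
        alternating_Cons[OF Cons2.prems(2), of y] len] m
    by (simp add: nths_Cons_omit)
qed simp_all

text \<open>The explicit formula obeys the same recursion: the summands with \<open>i = 0\<close>,
  together with the terms in which \<open>x\<close> acts, form \<open>LD x f xs\<close>, and the
  others form minus the coboundary of \<iota>_x f.\<close>

lemma d_explicit:
  assumes "multilinear scale scaleV f" "alternating f" "length xs = n + 1"
  shows "pre_lie_coboundary scaleV mul \<rho> \<mu> n f xs = d f xs"
  using assms
proof (induction xs arbitrary: f n)
  case (Cons x xs)
  show ?case
  proof (cases n)
    case 0
    then show ?thesis using Cons.prems by (simp add: pre_lie_coboundary_def)
  next
    case (Suc m)
    then have len: "length xs = Suc m" using Cons.prems by simp
    let ?f = "\<lambda>l. f (x # l)"
    let ?t = "\<lambda>xs i j. scaleV ((- 1) ^ (i + j))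
      (f (bracket (xs ! i) (xs ! j) # nths xs (- {i, j})))"
    \<comment> \<open>Shifting both indices leaves \<open>(- 1) ^ (i + j)\<close> unchanged; the
      minus sign of the recursion comes from moving the bracket past \<open>x\<close>.\<close>
    have skew: "f (bracket (xs ! i) (xs ! j) # x # nths xs (- {i, j})) =
        - f (x # bracket (xs ! i) (xs ! j) # nths xs (- {i, j}))" if "i < j" "j < m" for i j
    proof -
      have "nths xs (- {i, j}) \<noteq> []" using that len by (intro nths_omit_neq_Nil[of m]) auto
      from pair.multilinear_skew[OF Cons.prems(1,2) this, of "[]"] show ?thesis by (metis append_Nil)
    qed
    have "(\<Sum>j<n. \<Sum>i<j. ?t (x # xs) i j) = (\<Sum>j<m. \<Sum>i<Suc j. ?t (x # xs) i (Suc j))"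
      unfolding Suc sum.lessThan_Suc_shift by simp
    also have "\<dots> = (\<Sum>j<m. - scaleV ((- 1) ^ j) (f (bracket x (xs ! j) # nths xs (- {j})))
        - (\<Sum>i<j. scaleV ((- 1) ^ (i + j)) (?f (bracket (xs ! i) (xs ! j) # nths xs (- {i, j})))))"
    proof (rule sum.cong[OF refl])
      fix j assume "j \<in> {..<m}"
      then show "(\<Sum>i<Suc j. ?t (x # xs) i (Suc j)) =
          - scaleV ((- 1) ^ j) (f (bracket x (xs ! j) # nths xs (- {j})))
          - (\<Sum>i<j. scaleV ((- 1) ^ (i + j)) (?f (bracket (xs ! i) (xs ! j) # nths xs (- {i, j}))))"
        unfolding sum.lessThan_Suc_shift
        using skew by (simp add: nths_Cons_omit sum_negf)
    qed
    finally have brackets: "(\<Sum>j<n. \<Sum>i<j. ?t (x # xs) i j) =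
        - (\<Sum>j<m. scaleV ((- 1) ^ j) (f (bracket x (xs ! j) # nths xs (- {j}))))
        - (\<Sum>j<m. \<Sum>i<j. scaleV ((- 1) ^ (i + j))
            (?f (bracket (xs ! i) (xs ! j) # nths xs (- {i, j}))))"
      by (simp add: sum_subtractf sum_negf)
    have "pre_lie_coboundary scaleV mul \<rho> \<mu> n f (x # xs) =
        LD x f xs - pre_lie_coboundary scaleV mul \<rho> \<mu> m ?f xs"
      unfolding pre_lie_coboundary_def brackets LD_explicit[OF Cons.prems(1,2) len]
      using len Suc by (simp add: sum.lessThan_Suc_shift nths_Cons_omit sum_negf del: sum.lessThan_Suc)
    also have "pre_lie_coboundary scaleV mul \<rho> \<mu> m ?f xs = d ?f xs"
      using pair.multilinear_Cons[OF Cons.prems(1)] alternating_Cons[OF Cons.prems(2)] len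
      by (intro Cons.IH) simp_all
    finally show ?thesis by simp
  qed
qed simp

lemma pre_lie_coboundary_eq_d:
  "f \<in> cochains scale scaleV n \<Longrightarrow> pre_lie_coboundary scaleV mul \<rho> \<mu> n f = d f"
  unfolding pair.cochains_iff
  using d_explicit[of f _ n] d_wrong_length[of n f] by (auto simp: pre_lie_coboundary_def fun_eq_iff)

end

section \<open>Compatible structures\<close>

context compatible_pre_lie_representation
begin

text \<open>After bilinear expansion, the pure terms of each axiom are the axioms of the two
  structures, and the mixed terms are a compatibility condition.\<close>

lemma pre_lie_representation_sum:
  "pre_lie_representation scale (\<lambda>x y. dot x y + ast x y) scaleV
    (\<lambda>x v. \<rho> x v + \<rho>t x v) (\<lambda>x v. \<mu> x v + \<mu>t x v)"
proof
  show "bilinear_map scale scale scale (\<lambda>x y. dot x y + ast x y)"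
    "bilinear_map scale scaleV scaleV (\<lambda>x v. \<rho> x v + \<rho>t x v)"
    "bilinear_map scale scaleV scaleV (\<lambda>x v. \<mu> x v + \<mu>t x v)"
    unfolding bilinear_map_def dot.pair.linear_iff_lincomb dot.self.linear_iff_lincomb
      dot.selfV.linear_iff_lincomb
    by (simp_all add: dot.bilinear_lincomb ast.bilinear_lincomb dot.scale_right_distrib
        dot.V.scale_right_distrib)
next
  have dot_add: "dot (x + y) z = dot x z + dot y z" "dot z (x + y) = dot z x + dot z y" for x y z
    using dot.bilinear_lincomb(1,2)[where c = 1] by simp_all
  have ast_add: "ast (x + y) z = ast x z + ast y z" "ast z (x + y) = ast z x + ast z y" for x y z
    using ast.bilinear_lincomb(1,2)[where c = 1] by simp_all
  have act_add: "\<rho> (x + y) v = \<rho> x v + \<rho> y v" "\<rho>t (x + y) v = \<rho>t x v + \<rho>t y v"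
    "\<mu> (x + y) v = \<mu> x v + \<mu> y v" "\<mu>t (x + y) v = \<mu>t x v + \<mu>t y v" for x y v
    using dot.bilinear_lincomb(3,5)[where c = 1] ast.bilinear_lincomb(3,5)[where c = 1] by simp_all
  have act_diff: "\<rho> (x - y) v = \<rho> x v - \<rho> y v" "\<rho>t (x - y) v = \<rho>t x v - \<rho>t y v" for x y v
    using dot.bilinear_lincomb(3)[of "- 1" y x] ast.bilinear_lincomb(3)[of "- 1" y x] by simp_all
  note add = dot_add ast_add act_add act_diff dot.module_add ast.module_add
  fix x y z v
  show "dot (dot x y + ast x y) z + ast (dot x y + ast x y) z
      - (dot x (dot y z + ast y z) + ast x (dot y z + ast y z)) =
      dot (dot y x + ast y x) z + ast (dot y x + ast y x) z
      - (dot y (dot x z + ast x z) + ast y (dot x z + ast x z))"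
    using arg_cong2[where f = "(+)", OF arg_cong2[where f = "(+)",
        OF dot.left_symmetric[of x y z] ast.left_symmetric[of x y z]] compatible[of x y z]]
    by (simp add: add algebra_simps)
  show "\<rho> (dot x y + ast x y - (dot y x + ast y x)) v + \<rho>t (dot x y + ast x y - (dot y x + ast y x)) v =
      \<rho> x (\<rho> y v + \<rho>t y v) + \<rho>t x (\<rho> y v + \<rho>t y v) - (\<rho> y (\<rho> x v + \<rho>t x v) + \<rho>t y (\<rho> x v + \<rho>t x v))"
    using arg_cong2[where f = "(+)", OF arg_cong2[where f = "(+)",
        OF dot.rep_rho[of x y v] ast.rep_rho[of x y v]] compatible_rho[of x y v]]
    by (simp add: add algebra_simps)
  show "\<mu> y (\<mu> x v + \<mu>t x v) + \<mu>t y (\<mu> x v + \<mu>t x v) - (\<mu> (dot x y + ast x y) v + \<mu>t (dot x y + ast x y) v) =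
      \<mu> y (\<rho> x v + \<rho>t x v) + \<mu>t y (\<rho> x v + \<rho>t x v) - (\<rho> x (\<mu> y v + \<mu>t y v) + \<rho>t x (\<mu> y v + \<mu>t y v))"
    \<comment> \<open>\<open>compatible_mu\<close> is reversed so that
      \<open>\<mu>t y (\<mu> x v)\<close> joins the left side of the sum with positive sign.\<close>
    using arg_cong2[where f = "(+)", OF arg_cong2[where f = "(+)",
        OF dot.rep_mu[of y x v] ast.rep_mu[of y x v]] compatible_mu[of y x v, symmetric]]
    by (simp add: add algebra_simps)
qed

interpretation total: pre_lie_representation scale "\<lambda>x y. dot x y + ast x y" scaleV
  "\<lambda>x v. \<rho> x v + \<rho>t x v" "\<lambda>x v. \<mu> x v + \<mu>t x v"
  by (rule pre_lie_representation_sum)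

text \<open>The Lie derivative depends linearly on product and actions jointly; multilinearity
  splits \<open>f\<close> at the summed product and bracket.\<close>

lemma total_LD:
  "multilinear scale scaleV f \<Longrightarrow> total.LD x f xs = dot.LD x f xs + ast.LD x f xs"
proof (induction xs arbitrary: f rule: list_induct_singleton)
  case (Single z)
  show ?case
    using dot.pair.multilinear_add[OF Single, of "[]" _ _ "[]"] by simp
next
  case (Cons2 y u us)
  have "f (total.bracket x y # u # us) = f (dot.bracket x y # u # us) + f (ast.bracket x y # u # us)"
    using dot.pair.multilinear_add[OF Cons2.prems, of "[]" "dot.bracket x y" "ast.bracket x y"]
    by (simp add: algebra_simps)
  then show ?case using Cons2.IH[OF dot.pair.multilinear_Cons[OF Cons2.prems]] by simp
qed simp

lemma total_d:
  "multilinear scale scaleV f \<Longrightarrow> total.d f xs = dot.d f xs + ast.d f xs"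
  by (induction xs arbitrary: f) (simp_all add: total_LD dot.pair.multilinear_Cons)

lemma d_anticommute:
  assumes f: "multilinear scale scaleV f"
  shows "dot.d (ast.d f) xs + ast.d (dot.d f) xs = 0"
proof -
  have "0 = total.d (total.d f) xs"
    using total.d_d[OF f] by simp
  also have "\<dots> = dot.d (total.d f) xs + ast.d (total.d f) xs"
    by (rule total_d[OF total.multilinear_d[OF f]])
  also have "\<dots> = dot.d (\<lambda>l. dot.d f l + ast.d f l) xs + ast.d (\<lambda>l. dot.d f l + ast.d f l) xs"
    by (simp only: total_d[OF f])
  also have "\<dots> = dot.d (ast.d f) xs + ast.d (dot.d f) xs"
    by (simp add: dot.d_add_fun ast.d_add_fun dot.d_d[OF f] ast.d_d[OF f])
  finally show ?thesis by simp
qed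

section \<open>The complex of tuples of cochains\<close>

lemma cochains_add:
  assumes "f \<in> cochains scale scaleV n" "g \<in> cochains scale scaleV n"
  shows "(\<lambda>l. f l + g l) \<in> cochains scale scaleV n"
  unfolding dot.pair.cochains_iff
proof (intro conjI)
  show "multilinear scale scaleV (\<lambda>l. f l + g l)"
    using assms unfolding dot.pair.cochains_iff
    by (intro dot.pair.multilinear_lincombI)
      (simp add: assms(1,2)[unfolded dot.pair.cochains_iff, THEN conjunct1, THEN dot.pair.multilinear_lincomb]
        dot.V.scale_right_distrib)
qed (use assms in \<open>auto simp: dot.pair.cochains_iff alternating_def\<close>)

lemma zero_cochain: "(\<lambda>_. 0) \<in> cochains scale scaleV n"
  by (simp add: cochains_def dot.pair.linear_iff_lincomb)

abbreviation coboundary :: "nat \<Rightarrow> ('g list \<Rightarrow> 'v) list \<Rightarrow> ('g list \<Rightarrow> 'v) list"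
  where "coboundary \<equiv> compatible_coboundary scaleV dot ast \<rho> \<mu> \<rho>t \<mu>t"

text \<open>The three cases in the definition of the coboundary become one when the components
  \<open>f\<^sub>0\<close> and \<open>f\<^sub>n\<^sub>+\<^sub>1\<close> are read as 0.\<close>

definition component :: "('g list \<Rightarrow> 'v) list \<Rightarrow> nat \<Rightarrow> 'g list \<Rightarrow> 'v"
  where "component fs k = (if 1 \<le> k \<and> k \<le> length fs then fs ! (k - 1) else (\<lambda>_. 0))"

lemma component_cochains:
  "fs \<in> compatible_cochains scale scaleV n \<Longrightarrow> component fs k \<in> cochains scale scaleV n"
  by (auto simp: compatible_cochains_def component_def zero_cochain)

lemma length_coboundary: "1 \<le> n \<Longrightarrow> length (coboundary n fs) = n + 1"
  by (simp add: compatible_coboundary_def Let_def)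

text \<open>At \<open>k = 1\<close> and \<open>k = n + 1\<close> one summand is the coboundary of
  the zero function, so the end entries fit the middle pattern.\<close>

lemma component_coboundary:
  assumes fs: "fs \<in> compatible_cochains scale scaleV n" and "1 \<le> n" and k: "1 \<le> k" "k \<le> n + 1"
  shows "component (coboundary n fs) k = (\<lambda>xs. ast.d (component fs (k - 1)) xs + dot.d (component fs k) xs)"
proof -
  have len: "length fs = n" and coch: "i < n \<Longrightarrow> fs ! i \<in> cochains scale scaleV n" for i
    using fs by (auto simp: compatible_cochains_def)
  have eq: "i < n \<Longrightarrow> pre_lie_coboundary scaleV dot \<rho> \<mu> n (fs ! i) = dot.d (fs ! i)"
    "i < n \<Longrightarrow> pre_lie_coboundary scaleV ast \<rho>t \<mu>t n (fs ! i) = ast.d (fs ! i)" for i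
    using coch by (simp_all add: dot.pre_lie_coboundary_eq_d ast.pre_lie_coboundary_eq_d)
  have nth: "component (coboundary n fs) k = coboundary n fs ! (k - 1)"
    using k \<open>1 \<le> n\<close> by (simp add: component_def length_coboundary)
  consider "k = 1" | "2 \<le> k" "k \<le> n" | "k = n + 1" using k by linarith
  then show ?thesis
  proof cases
    case 1
    then show ?thesis using \<open>1 \<le> n\<close>
      by (simp add: nth compatible_coboundary_def Let_def component_def len eq ast.d_zero_fun)
  next
    case 2
    \<comment> \<open>Component \<open>k\<close> is list entry \<open>k - 1 = i + 1\<close>, which
      is entry \<open>i\<close> of the map over \<open>[1..<n]\<close>.\<close>
    then obtain i where i: "k = i + 2" "i < n - 1" "i + 1 < n" using that[of "k - 2"] by simp
    then show ?thesis
      by (simp add: nth compatible_coboundary_def Let_def component_def len eq nth_append)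
  next
    case 3
    then show ?thesis using \<open>1 \<le> n\<close>
      by (simp add: nth compatible_coboundary_def Let_def component_def len eq dot.d_zero_fun nth_append)
  qed
qed

lemma nth_component: "i < length fs \<Longrightarrow> fs ! i = component fs (i + 1)"
  by (simp add: component_def)

lemma coboundary_cochains:
  assumes fs: "fs \<in> compatible_cochains scale scaleV n" and "1 \<le> n"
  shows "coboundary n fs \<in> compatible_cochains scale scaleV (n + 1)"
proof -
  have "coboundary n fs ! i \<in> cochains scale scaleV (n + 1)" if "i < n + 1" for i
    using that \<open>1 \<le> n\<close> component_coboundary[OF fs, of "i + 1"]
      cochains_add[OF ast.d_cochains dot.d_cochains, OF component_cochains[OF fs] component_cochains[OF fs]]
    by (simp add: nth_component length_coboundary)
  then show ?thesis
    using length_coboundary[OF \<open>1 \<le> n\<close>, of fs]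
    by (auto simp: compatible_cochains_def set_conv_nth)
qed

text \<open>Entry \<open>i\<close> expands to two squares, which vanish, and to both mixed
  composites applied to the same component \<open>i\<close> of \<open>fs\<close>, which cancel by
  \<open>d_anticommute\<close>.\<close>

lemma coboundary_coboundary:
  assumes fs: "fs \<in> compatible_cochains scale scaleV n" and "1 \<le> n"
  shows "coboundary (n + 1) (coboundary n fs) = replicate (n + 2) (\<lambda>_. 0)"
proof (rule nth_equalityI)
  show len: "length (coboundary (n + 1) (coboundary n fs)) = length (replicate (n + 2) (\<lambda>_. 0))"
    by (simp add: length_coboundary)
  fix i assume "i < length (coboundary (n + 1) (coboundary n fs))"
  then have i: "i < n + 2" using len by simp
  let ?c = "component fs"
  have ml: "multilinear scale scaleV (?c k)" for k
    using component_cochains[OF fs] by (simp add: dot.pair.cochains_iff)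
  have ast_d: "ast.d (component (coboundary n fs) i) xs = ast.d (dot.d (?c i)) xs" for xs
  \<comment> \<open>Component 0 is outside the range of \<open>component_coboundary\<close>; both
    sides are coboundaries of zero. The case \<open>i = n + 1\<close> below is the same at the other
    end.\<close>
  proof (cases "i = 0")
    case True
    then show ?thesis by (simp add: component_def ast.d_zero_fun dot.d_zero_fun)
  next
    case False
    then show ?thesis
      using component_coboundary[OF fs \<open>1 \<le> n\<close>, of i] i
      by (simp add: ast.d_add_fun ast.d_d[OF ml])
  qed
  have dot_d: "dot.d (component (coboundary n fs) (i + 1)) xs = dot.d (ast.d (?c i)) xs" for xs
  proof (cases "i = n + 1")
    case True
    then show ?thesis
      using fs \<open>1 \<le> n\<close> by (simp add: component_def length_coboundary compatible_cochains_def
          ast.d_zero_fun dot.d_zero_fun)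
  next
    case False
    then show ?thesis
      using component_coboundary[OF fs \<open>1 \<le> n\<close>, of "i + 1"] i
      by (simp add: dot.d_add_fun dot.d_d[OF ml])
  qed
  have "coboundary (n + 1) (coboundary n fs) ! i =
      component (coboundary (n + 1) (coboundary n fs)) (i + 1)"
    using i by (intro nth_component) (simp add: length_coboundary)
  also have "\<dots> = (\<lambda>xs. ast.d (component (coboundary n fs) i) xs
      + dot.d (component (coboundary n fs) (i + 1)) xs)"
    using component_coboundary[OF coboundary_cochains[OF assms], of "i + 1"] i by simp
  also have "\<dots> = (\<lambda>_. 0)"
    unfolding ast_d dot_d using d_anticommute[OF ml] by (simp add: add.commute)
  finally show "coboundary (n + 1) (coboundary n fs) ! i = replicate (n + 2) (\<lambda>_. 0) ! i"
    using i by (simp only: nth_replicate)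
qed

end

theorem theorem4p5:
  fixes scale :: "'k::field \<Rightarrow> 'g::ab_group_add \<Rightarrow> 'g"
    and scaleV :: "'k \<Rightarrow> 'v::ab_group_add \<Rightarrow> 'v"
    and \<pi>1 \<pi>2 :: "'g \<Rightarrow> 'g \<Rightarrow> 'g"
    and \<rho> \<mu> \<rho>t \<mu>t :: "'g \<Rightarrow> 'v \<Rightarrow> 'v"
    and n :: nat
    and fs :: "('g list \<Rightarrow> 'v) list"
  assumes "compatible_pre_lie_algebra scale \<pi>1 \<pi>2"
    and "compatible_pre_lie_representation scale \<pi>1 \<pi>2 scaleV \<rho> \<mu> \<rho>t \<mu>t"
    and "n \<ge> 1"
    and "fs \<in> compatible_cochains scale scaleV n"
  shows "compatible_coboundary scaleV \<pi>1 \<pi>2 \<rho> \<mu> \<rho>t \<mu>t n fs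
           \<in> compatible_cochains scale scaleV (n + 1)
    \<and> compatible_coboundary scaleV \<pi>1 \<pi>2 \<rho> \<mu> \<rho>t \<mu>t (n + 1)
        (compatible_coboundary scaleV \<pi>1 \<pi>2 \<rho> \<mu> \<rho>t \<mu>t n fs)
      = replicate (n + 2) (\<lambda>_. 0)"
proof -
  interpret compatible_pre_lie_representation scale \<pi>1 \<pi>2 scaleV \<rho> \<mu> \<rho>t \<mu>t
    by fact
  show ?thesis
    using coboundary_cochains coboundary_coboundary assms(3,4) by blast
qed

end
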